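(* Let $(X,d)$ be a metric space in which every ball is finite. Put $m=\min\{|\overline{B}(x,1)|:x\in X\}$ and $X'=\{x\in X:|\overline{B}(x,1)|=m\}$. If $X'$ is finite, then $X$ is plastic.
   Context: $\overline{B}(x,r)$ is the closed ball of radius $r>0$ centred at $x$; "every ball is finite" means that $\overline{B}(x,r)$ is a finite set for every $x\in X$ and $r>0$. A map $f$ is nonexpansive if $d(f(x),f(y))\le d(x,y)$ for all $x,y$. A metric space is plastic if every bijective nonexpansive self-map is an isometry. *)

theory Defs
  imports "HOL-Analysis.Analysis"
begin

context Metric_space
begin

definition nonexpansive :: "('a \<Rightarrow> 'a) \<Rightarrow> bool" where
  "nonexpansive f \<longleftrightarrow> f \<in> M \<rightarrow> M \<and> (\<forall>x\<in>M. \<forall>y\<in>M. d (f x) (f y) \<le> d x y)"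

definition isometry :: "('a \<Rightarrow> 'a) \<Rightarrow> bool" where
  "isometry f \<longleftrightarrow> f \<in> M \<rightarrow> M \<and> (\<forall>x\<in>M. \<forall>y\<in>M. d (f x) (f y) = d x y)"

definition plastic :: bool where
  "plastic \<longleftrightarrow> (\<forall>f. bij_betw f M M \<and> nonexpansive f \<longrightarrow> isometry f)"

text \<open>The set of cardinalities may be infinite, so \<open>Min\<close> is not available; on a nonempty set of
  naturals the infimum is attained and is the minimum. For \<open>M = {}\<close> the value is irrelevant.\<close>

definition min_unit_ball_card :: nat where
  "min_unit_ball_card = (INF x\<in>M. card (mcball x 1))"

definition min_unit_ball_points :: "'a set" where
  "min_unit_ball_points = {x \<in> M. card (mcball x 1) = min_unit_ball_card}"

end

end

theory Submission
  imports Defs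
begin

text \<open>
  A nonexpansive map \<open>f\<close> that carries a finite set \<open>S\<close> onto itself preserves all distances in \<open>S\<close>:
  it permutes the pairs of points of \<open>S\<close>, so the sum of the distances over these pairs does not
  change, although no single distance can grow.

  It therefore suffices to exhaust the space by finite sets that a given nonexpansive bijection
  maps onto themselves. The map sends a unit ball injectively into the unit ball around the image
  of its centre, so the cardinality of unit balls can only grow along the map. The preimage of a
  point with minimal unit ball thus again has a minimal unit ball, and the finite, nonempty set
  \<open>F\<close> of these points is mapped onto itself. An injective nonexpansive map with \<open>f ` F = F\<close> sends
  the union of the balls of radius \<open>r\<close> around the points of \<open>F\<close> into itself, hence onto itself, as
  this union is finite. Any two points of the space lie in this union once \<open>r\<close> is large.
\<close>

context Metric_space
begin

lemma nonexpansive_image_mcball: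
  assumes "nonexpansive f" and "x \<in> M"
  shows "f ` mcball x r \<subseteq> mcball (f x) r"
  using assms unfolding nonexpansive_def by (force intro: order_trans)

text \<open>Both sides of the distance inequality have the same sum over \<open>S \<times> S\<close>, because \<open>f\<close> permutes
  \<open>S\<close>; so the inequality cannot be strict anywhere.\<close>

lemma nonexpansive_onto_finite_preserves_dist:
  assumes f: "nonexpansive f" and S: "finite S" "S \<subseteq> M" "f ` S = S"
    and xy: "x \<in> S" "y \<in> S"
  shows "d (f x) (f y) = d x y"
proof -
  have "inj_on f S"
    using S by (intro eq_card_imp_inj_on) auto
  then have "bij_betw f S S"
    using S by (simp add: bij_betw_def)
  then have "bij_betw (map_prod f f) (S \<times> S) (S \<times> S)"
    by (intro bij_betw_map_prod)
  then have "(\<Sum>p\<in>S \<times> S. case_prod d (map_prod f f p)) = (\<Sum>p\<in>S \<times> S. case_prod d p)"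
    by (rule sum.reindex_bij_betw)
  moreover have "case_prod d (map_prod f f p) \<le> case_prod d p" if p: "p \<in> S \<times> S" for p
  proof -
    obtain u v where uv: "p = (u, v)" "u \<in> S" "v \<in> S"
      using p by blast
    then have "d (f u) (f v) \<le> d u v"
      using f S(2) unfolding nonexpansive_def by blast
    then show ?thesis using uv(1) by simp
  qed
  moreover have "(x, y) \<in> S \<times> S" "finite (S \<times> S)"
    using xy S(1) by simp_all
  ultimately have "case_prod d (map_prod f f (x, y)) = case_prod d (x, y)"
    by (rule sum_mono_inv)
  then show ?thesis by simp
qed

lemma min_unit_ball_card_le:
  "x \<in> M \<Longrightarrow> min_unit_ball_card \<le> card (mcball x 1)"
  unfolding min_unit_ball_card_def by (rule cINF_lower) auto

lemma min_unit_ball_points_nonempty: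
  assumes "M \<noteq> {}"
  shows "min_unit_ball_points \<noteq> {}"
proof -
  have "min_unit_ball_card \<in> (\<lambda>x. card (mcball x 1)) ` M"
    unfolding min_unit_ball_card_def using assms by (intro Inf_nat_def1) auto
  then show ?thesis
    by (auto simp: min_unit_ball_points_def)
qed

text \<open>Preimages of points with minimal unit ball again have minimal unit ball, so the image covers
  the set; finiteness then excludes that it is larger.\<close>

lemma image_min_unit_ball_points:
  assumes f: "bij_betw f M M" "nonexpansive f"
    and balls: "\<And>x. x \<in> M \<Longrightarrow> finite (mcball x 1)"
    and fin: "finite min_unit_ball_points"
  shows "f ` min_unit_ball_points = min_unit_ball_points"
proof -
  have "min_unit_ball_points \<subseteq> f ` min_unit_ball_points"
  proof
    fix y assume y: "y \<in> min_unit_ball_points"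
    then have "y \<in> f ` M"
      using f(1) by (simp add: bij_betw_def min_unit_ball_points_def)
    then obtain x where x: "x \<in> M" "y = f x" by blast
    have "inj_on f (mcball x 1)"
      using f(1) by (auto simp: bij_betw_def intro: inj_on_subset)
    moreover have "finite (mcball (f x) 1)"
      using y x by (intro balls) (simp add: min_unit_ball_points_def)
    ultimately have "card (mcball x 1) \<le> card (mcball (f x) 1)"
      using nonexpansive_image_mcball[OF f(2) x(1)] by (metis card_inj_on_le)
    also have "\<dots> = min_unit_ball_card"
      using y x by (simp add: min_unit_ball_points_def)
    finally have "x \<in> min_unit_ball_points"
      using min_unit_ball_card_le[OF x(1)] x(1) by (simp add: min_unit_ball_points_def)
    then show "y \<in> f ` min_unit_ball_points" using x by blast
  qed
  then show ?thesis
    using fin by (metis card_image_le card_seteq finite_imageI)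
qed

text \<open>A nonempty finite set \<open>F\<close> with \<open>f ` F = F\<close> takes the place of a fixed point: instead of balls
  around one point, the unions of balls around \<open>F\<close> are the invariant finite sets.\<close>

lemma nonexpansive_inj_finite_invariant_imp_isometry:
  assumes f: "inj_on f M" "nonexpansive f"
    and balls: "\<And>x r. x \<in> M \<Longrightarrow> r > 0 \<Longrightarrow> finite (mcball x r)"
    and F: "finite F" "F \<subseteq> M" "F \<noteq> {}" "f ` F = F"
  shows "isometry f"
proof -
  have "d (f x) (f y) = d x y" if xy: "x \<in> M" "y \<in> M" for x y
  proof -
    obtain a where a: "a \<in> F" using F(3) by blast
    define r where "r = 1 + d a x + d a y"
    define S where "S = (\<Union>z\<in>F. mcball z r)"
    have "r > 0" by (simp add: r_def add_pos_nonneg)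
    then have S: "finite S" "S \<subseteq> M"
      using F balls by (auto simp: S_def)
    have "f ` S \<subseteq> S"
    proof -
      have "f ` mcball z r \<subseteq> S" if "z \<in> F" for z
        using nonexpansive_image_mcball[OF f(2), of z r] that F(2,4) unfolding S_def by blast
      then show ?thesis unfolding S_def by blast
    qed
    moreover have "inj_on f S" using f(1) S(2) by (rule inj_on_subset)
    ultimately have "f ` S = S" using S(1) by (simp add: endo_inj_surj)
    moreover have "x \<in> S" "y \<in> S"
      using a xy F(2) by (auto simp: S_def r_def intro!: bexI[of _ a])
    ultimately show ?thesis
      using nonexpansive_onto_finite_preserves_dist[OF f(2) S] by blast
  qed
  then show ?thesis
    using f(2) by (simp add: isometry_def nonexpansive_def)
qed

end

theorem theorem6p4:
  fixes M :: "'a set" and d :: "'a \<Rightarrow> 'a \<Rightarrow> real"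
  assumes "Metric_space M d"
    and "\<And>x r. x \<in> M \<Longrightarrow> r > 0 \<Longrightarrow> finite (Metric_space.mcball M d x r)"
    and "finite (Metric_space.min_unit_ball_points M d)"
  shows "Metric_space.plastic M d"
proof -
  interpret Metric_space M d by fact
  have "isometry f" if f: "bij_betw f M M" "nonexpansive f" for f
  proof (cases "M = {}")
    case True
    then have "d (f x) (f y) = d x y" if "x \<in> M" for x y
      using that by blast
    then show ?thesis
      using f(2) unfolding isometry_def nonexpansive_def by blast
  next
    case False
    show ?thesis
    proof (rule nonexpansive_inj_finite_invariant_imp_isometry)
      show "f ` min_unit_ball_points = min_unit_ball_points"
        using f assms(2,3) by (intro image_min_unit_ball_points) auto
      show "min_unit_ball_points \<noteq> {}"
        using False by (rule min_unit_ball_points_nonempty)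
      show "min_unit_ball_points \<subseteq> M"
        by (auto simp: min_unit_ball_points_def)
    qed (use f assms(2,3) in \<open>auto simp: bij_betw_def\<close>)
  qed
  then show ?thesis
    by (simp add: plastic_def)
qed

end
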